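(* Let $m\ge 1$ be an integer and $h>0$ a real number, and let $D_m[\beta]$, $\beta\in\mathbb{Z}$, be the discrete analogue of the differential operator $\frac{d^{2m}}{dx^{2m}}$. Write $[\beta]^k=(h\beta)^k$. Then $$ \sum_{\beta\in\mathbb{Z}}D_m[\beta][\beta]^k=\begin{cases}0 & \text{for } 0\le k\le 2m-1,\\ (2m)! & \text{for } k=2m,\end{cases} $$ and $$ \sum_{\beta\in\mathbb{Z}}D_m[\beta][\beta]^k=\begin{cases}0 & \text{for } 2m+1\le k\le 4m-1,\\[1mm] \dfrac{h^{2m}(4m)!\,B_{2m}}{(2m)!} & \text{for } k=4m,\end{cases} $$ where $B_{2m}$ is the Bernoulli number.
   Context: Functions of discrete argument are functions on $\mathbb{Z}$; $h>0$ is the lattice step. Put $G_m[\beta]=\frac{(h\beta)^{2m-1}\operatorname{sign}(h\beta)}{2\,(2m-1)!}$, and $\delta[\beta]=1$ if $\beta=0$, $\delta[\beta]=0$ otherwise. Convolution is $\varphi[\beta]*\psi[\beta]=\sum_{\gamma\in\mathbb{Z}}\varphi[\gamma]\psi[\beta-\gamma]$. The discrete analogue of $d^{2m}/dx^{2m}$ is the function $D_m:\mathbb{Z}\to\mathbb{R}$ such that $h\,D_m[\beta]*G_m[\beta]=\delta[\beta]$ for all $\beta\in\mathbb{Z}$, where the convolution series are required to converge absolutely. In $[\beta]^0$ the convention $0^0=1$ is used. Bernoulli numbers are normalized so that $\sum_{\gamma=1}^{\infty}\gamma^{-2m}=\frac{(-1)^{m-1}(2\pi)^{2m}B_{2m}}{2\,(2m)!}$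 (e.g. $B_2=1/6$). *)

theory Defs
  imports "HOL-Analysis.Analysis"
begin

definition dconv :: "(int \<Rightarrow> real) \<Rightarrow> (int \<Rightarrow> real) \<Rightarrow> int \<Rightarrow> real" where
  "dconv \<phi> \<psi> \<beta> = (\<Sum>\<^sub>\<infinity>\<gamma>\<in>UNIV. \<phi> \<gamma> * \<psi> (\<beta> - \<gamma>))"

definition dconv_converges :: "(int \<Rightarrow> real) \<Rightarrow> (int \<Rightarrow> real) \<Rightarrow> bool" where
  "dconv_converges \<phi> \<psi> \<longleftrightarrow> (\<forall>\<beta>. (\<lambda>\<gamma>. \<bar>\<phi> \<gamma> * \<psi> (\<beta> - \<gamma>)\<bar>) summable_on UNIV)"

definition ddelta :: "int \<Rightarrow> real" where
  "ddelta \<beta> = (if \<beta> = 0 then 1 else 0)"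

definition G_fun :: "nat \<Rightarrow> real \<Rightarrow> int \<Rightarrow> real" where
  "G_fun m h \<beta> =
     (h * of_int \<beta>) ^ (2 * m - 1) * sgn (h * of_int \<beta>) / (2 * fact (2 * m - 1))"

definition is_discrete_analogue :: "nat \<Rightarrow> real \<Rightarrow> (int \<Rightarrow> real) \<Rightarrow> bool" where
  "is_discrete_analogue m h D \<longleftrightarrow>
     dconv_converges D (G_fun m h) \<and>
     (\<forall>\<beta>. h * dconv D (G_fun m h) \<beta> = ddelta \<beta>)"

(* Standard recursion: the sum of (n+1 choose k) * B_k over k \<le> n vanishes for n > 0.
   Its even-indexed values satisfy
   zeta (2 m) = (-1)^(m-1) * (2 pi)^(2 m) * B_(2 m) / (2 * (2 m)!). *)
fun bernoulli :: "nat \<Rightarrow> real" where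
  "bernoulli 0 = 1"
| "bernoulli (Suc n) =
     - (\<Sum>k\<le>n. of_nat ((n + 2) choose k) * bernoulli k) / of_nat (n + 2)"

lemma bernoulli_2: "bernoulli 2 = 1 / 6"
  by (simp add: numeral_2_eq_2)

end

(*
  Applying the 2m-th difference (1 - z)^(2m) to G_m turns the convolution equation into
  E(z) D(z) = c (1 - z)^(2m), where E is essentially the Eulerian polynomial of degree 2m - 1.
  On the unit circle, E(e^(i t)) / (1 - e^(i t))^(2m) is a nonzero multiple of an odd-order
  derivative of cot (t/2), which as a polynomial in cot (t/2) is even with nonnegative coefficients
  and positive constant term.  Hence E has no zero of modulus 1, and splitting it into linear factors
  shows that the bounded sequence D decreases rapidly.  All moments of D therefore exist, and
  substituting z = e^x gives a formal identity for their exponential generating function.  Since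
  E(e^x) / (1 - e^x)^(2m) is the (2m-1)-st derivative of (1 + e^x) / (1 - e^x), whose Laurent
  coefficients are Bernoulli numbers, it has the form a x^(-2m) + b B_(2m) + O(x); inverting this
  series gives the moments up to order 4m.
*)
theory Submission
  imports
    Defs
    "HOL-Computational_Algebra.Fundamental_Theorem_Algebra"
    "HOL-Real_Asymp.Real_Asymp"
begin

section \<open>Polynomials acting on sequences\<close>

definition poly_act :: "'a::idom poly \<Rightarrow> (int \<Rightarrow> 'a) \<Rightarrow> int \<Rightarrow> 'a" where
  "poly_act p x n = (\<Sum>j\<le>degree p. coeff p j * x (n - int j))"

lemma poly_act_atMost:
  assumes "degree p \<le> d"
  shows "poly_act p x n = (\<Sum>j\<le>d. coeff p j * x (n - int j))"
  unfolding poly_act_def using assms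
  by (intro sum.mono_neutral_left) (auto simp: coeff_eq_0)

lemma poly_act_0 [simp]: "poly_act 0 x n = 0"
  by (simp add: poly_act_def)

lemma poly_act_pCons [simp]:
  "poly_act (pCons a p) x n = a * x n + poly_act p x (n - 1)"
proof -
  have "poly_act (pCons a p) x n = (\<Sum>j\<le>Suc (degree p). coeff (pCons a p) j * x (n - int j))"
    by (rule poly_act_atMost) (simp add: degree_pCons_le)
  also have "\<dots> = a * x n + (\<Sum>j\<le>degree p. coeff p j * x (n - 1 - int j))"
    by (subst sum.atMost_Suc_shift) (simp add: algebra_simps)
  finally show ?thesis by (simp add: poly_act_def)
qed

lemma poly_act_diff: "poly_act [:1, -1:] x n = x n - x (n - 1)"
  by simp

lemma poly_act_add: "poly_act (p + q) x n = poly_act p x n + poly_act q x n"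
proof -
  let ?d = "max (degree p) (degree q)"
  have "degree (p + q) \<le> ?d" by (rule degree_add_le_max)
  then show ?thesis
    by (simp add: poly_act_atMost[of _ ?d] sum.distrib distrib_right)
qed

lemma poly_act_smult: "poly_act (smult a p) x n = a * poly_act p x n"
  by (simp add: poly_act_atMost[of _ "degree p"] degree_smult_le sum_distrib_left mult.assoc)

lemma poly_act_scale: "poly_act p (\<lambda>n. a * x n) n = a * poly_act p x n"
  by (simp add: poly_act_def sum_distrib_left mult.left_commute)

lemma poly_act_mult: "poly_act (p * q) x n = poly_act p (poly_act q x) n"
  by (induction p arbitrary: n) (simp_all add: poly_act_add poly_act_smult)

lemma poly_act_index:
  "of_int n * poly_act p x n =
     poly_act (pCons 0 (pderiv p)) x n + poly_act p (\<lambda>n. of_int n * x n) n"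
proof (induction p arbitrary: n)
  case (pCons a p)
  have "of_int n * poly_act p x (n - 1) = poly_act p x (n - 1) + of_int (n - 1) * poly_act p x (n - 1)"
    by (simp add: algebra_simps)
  then show ?case
    unfolding poly_act_pCons pderiv_pCons poly_act_add distrib_left pCons.IH[of "n - 1"]
    by (simp add: mult.left_commute add_ac)
qed simp

definition unit_impulse :: "int \<Rightarrow> 'a::zero_neq_one" where
  "unit_impulse n = (if n = 0 then 1 else 0)"

text \<open>Numerators of \<open>(z d/dz)\<^sup>n ((1 + z) / (1 - z))\<close> over the denominator \<open>(1 - z)\<^sup>n\<^sup>+\<^sup>1\<close>;
  for \<open>n \<ge> 1\<close> this is twice \<open>z\<close> times the Eulerian polynomial.\<close>
primrec euler_num :: "nat \<Rightarrow> 'a::idom poly" where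
  "euler_num 0 = [:1, 1:]"
| "euler_num (Suc n) =
     pCons 0 ([:1, -1:] * pderiv (euler_num n) + smult (of_nat (Suc n)) (euler_num n))"

lemma poly_act_diff_power_signed:
  "poly_act ([:1, -1:] ^ Suc n) (\<lambda>\<beta>. of_int \<beta> ^ n * of_int (sgn \<beta>)) =
     (poly_act (euler_num n) unit_impulse :: int \<Rightarrow> 'a::{idom, ring_char_0})"
proof (induction n)
  case 0
  show ?case by (rule ext) (auto simp: unit_impulse_def sgn_if)
next
  case (Suc n)
  let ?d = "[:1, -1:] :: 'a poly"
  let ?x = "\<lambda>\<beta>. of_int \<beta> ^ n * of_int (sgn \<beta>) :: 'a"
  have L0: "(\<lambda>\<beta>. of_int \<beta> * unit_impulse \<beta> :: 'a) = (\<lambda>_. 0)"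
    by (auto simp: unit_impulse_def)
  have pd: "pCons 0 (pderiv (?d ^ Suc n)) = smult (- of_nat (Suc n)) (pCons 0 (?d ^ n))"
    by (simp only: pderiv_power_Suc) (simp add: pderiv_pCons)
  have eq: "poly_act (?d ^ Suc n) (\<lambda>\<beta>. of_int \<beta> * ?x \<beta>) \<beta> =
      poly_act (pCons 0 (pderiv (euler_num n))) unit_impulse \<beta>
      + of_nat (Suc n) * poly_act (pCons 0 (?d ^ n)) ?x \<beta>" for \<beta>
  proof -
    have "of_int \<beta> * poly_act (?d ^ Suc n) ?x \<beta> = poly_act (pCons 0 (pderiv (euler_num n))) unit_impulse \<beta>"
      unfolding Suc.IH poly_act_index L0 by (simp add: poly_act_def)
    then show ?thesis
      using poly_act_index[of \<beta> "?d ^ Suc n" ?x] unfolding pd poly_act_smult by (simp add: algebra_simps)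
  qed
  have "poly_act (?d ^ Suc (Suc n)) (\<lambda>\<beta>. of_int \<beta> * ?x \<beta>) \<beta> =
          poly_act (euler_num (Suc n)) unit_impulse \<beta>" for \<beta>
  proof -
    have "poly_act (?d ^ Suc (Suc n)) (\<lambda>\<beta>. of_int \<beta> * ?x \<beta>) \<beta> =
            poly_act ?d (poly_act (?d ^ Suc n) (\<lambda>\<beta>. of_int \<beta> * ?x \<beta>)) \<beta>"
      by (simp only: power_Suc[of _ "Suc n"] poly_act_mult)
    also have "\<dots> = poly_act ?d (poly_act (pCons 0 (pderiv (euler_num n))) unit_impulse) \<beta>
        + of_nat (Suc n) * poly_act ?d (poly_act (pCons 0 (?d ^ n)) ?x) \<beta>"
      by (simp only: poly_act_diff eq right_diff_distrib add_diff_add)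
    also have "poly_act ?d (poly_act (pCons 0 (?d ^ n)) ?x) \<beta> =
               poly_act (euler_num n) unit_impulse (\<beta> - 1)"
    proof -
      have "?d * pCons 0 (?d ^ n) = pCons 0 (?d ^ Suc n)" by simp
      then show ?thesis
        unfolding poly_act_mult[symmetric] Suc.IH[symmetric] by (simp del: power_Suc)
    qed
    also have "poly_act ?d (poly_act (pCons 0 (pderiv (euler_num n))) unit_impulse) \<beta> =
               poly_act (?d * pderiv (euler_num n)) unit_impulse (\<beta> - 1)"
      by (simp add: poly_act_mult del: mult_pCons_left mult_pCons_right)
    finally show ?thesis by (simp add: poly_act_add poly_act_smult del: mult_pCons_left)
  qed
  then show ?case by (auto simp: mult.assoc)
qed

section \<open>Rapidly decreasing sequences\<close>

definition rapidly_decreasing :: "(int \<Rightarrow> 'a::real_normed_vector) \<Rightarrow> bool" where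
  "rapidly_decreasing x \<longleftrightarrow> (\<forall>k. \<exists>C. \<forall>n. norm (x n) * (1 + \<bar>real_of_int n\<bar>) ^ k \<le> C)"

lemma rapidly_decreasing_add:
  assumes "rapidly_decreasing x" "rapidly_decreasing y"
  shows "rapidly_decreasing (\<lambda>n. x n + y n)"
  unfolding rapidly_decreasing_def
proof
  fix k
  obtain C1 where C1: "\<And>n. norm (x n) * (1 + \<bar>real_of_int n\<bar>) ^ k \<le> C1"
    using assms(1) unfolding rapidly_decreasing_def by meson
  obtain C2 where C2: "\<And>n. norm (y n) * (1 + \<bar>real_of_int n\<bar>) ^ k \<le> C2"
    using assms(2) unfolding rapidly_decreasing_def by meson
  have "norm (x n + y n) * (1 + \<bar>real_of_int n\<bar>) ^ k \<le> C1 + C2" for n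
  proof -
    have "norm (x n + y n) * (1 + \<bar>real_of_int n\<bar>) ^ k
          \<le> (norm (x n) + norm (y n)) * (1 + \<bar>real_of_int n\<bar>) ^ k"
      by (intro mult_right_mono norm_triangle_ineq) auto
    with C1[of n] C2[of n] show ?thesis by (simp add: distrib_right)
  qed
  then show "\<exists>C. \<forall>n. norm (x n + y n) * (1 + \<bar>real_of_int n\<bar>) ^ k \<le> C" by blast
qed

lemma rapidly_decreasing_dominated:
  assumes "rapidly_decreasing x" "\<And>n. norm (y n) \<le> c * norm (x n)"
  shows "rapidly_decreasing y"
  unfolding rapidly_decreasing_def
proof
  fix k
  obtain C where C: "\<And>n. norm (x n) * (1 + \<bar>real_of_int n\<bar>) ^ k \<le> C"
    using assms(1) unfolding rapidly_decreasing_def by meson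
  have "norm (y n) * (1 + \<bar>real_of_int n\<bar>) ^ k \<le> \<bar>c\<bar> * C" for n
  proof -
    have "norm (y n) \<le> \<bar>c\<bar> * norm (x n)"
      using assms(2)[of n] mult_right_mono[OF abs_ge_self[of c] norm_ge_zero[of "x n"]] by linarith
    then have "norm (y n) * (1 + \<bar>real_of_int n\<bar>) ^ k
          \<le> (\<bar>c\<bar> * norm (x n)) * (1 + \<bar>real_of_int n\<bar>) ^ k"
      by (intro mult_right_mono) auto
    also have "\<dots> \<le> \<bar>c\<bar> * C"
      unfolding mult.assoc by (intro mult_left_mono C) auto
    finally show ?thesis .
  qed
  then show "\<exists>C. \<forall>n. norm (y n) * (1 + \<bar>real_of_int n\<bar>) ^ k \<le> C" by blast
qed

lemma weight_le:
  fixes a b :: int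
  shows "1 + \<bar>real_of_int (a + b)\<bar> \<le> (1 + \<bar>real_of_int a\<bar>) * (1 + \<bar>real_of_int b\<bar>)"
proof -
  have "1 + \<bar>real_of_int (a + b)\<bar> \<le> 1 + \<bar>real_of_int a\<bar> + \<bar>real_of_int b\<bar>" by simp
  also have "\<dots> \<le> (1 + \<bar>real_of_int a\<bar>) * (1 + \<bar>real_of_int b\<bar>)" by (simp add: algebra_simps)
  finally show ?thesis .
qed

lemma rapidly_decreasing_shift:
  assumes "rapidly_decreasing x"
  shows "rapidly_decreasing (\<lambda>n. x (n + a))"
  unfolding rapidly_decreasing_def
proof
  fix k
  obtain C where C: "\<And>n. norm (x n) * (1 + \<bar>real_of_int n\<bar>) ^ k \<le> C"
    using assms unfolding rapidly_decreasing_def by meson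
  have "norm (x (n + a)) * (1 + \<bar>real_of_int n\<bar>) ^ k \<le> C * (1 + \<bar>real_of_int a\<bar>) ^ k" for n
  proof -
    have "(1 + \<bar>real_of_int n\<bar>) ^ k \<le> ((1 + \<bar>real_of_int (n + a)\<bar>) * (1 + \<bar>real_of_int a\<bar>)) ^ k"
      using weight_le[of "n + a" "- a"] by (intro power_mono) auto
    then have "norm (x (n + a)) * (1 + \<bar>real_of_int n\<bar>) ^ k
       \<le> norm (x (n + a)) * (1 + \<bar>real_of_int (n + a)\<bar>) ^ k * (1 + \<bar>real_of_int a\<bar>) ^ k"
      unfolding power_mult_distrib mult.assoc by (intro mult_left_mono) auto
    also have "\<dots> \<le> C * (1 + \<bar>real_of_int a\<bar>) ^ k"
      by (intro mult_right_mono C) auto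
    finally show ?thesis .
  qed
  then show "\<exists>C. \<forall>n. norm (x (n + a)) * (1 + \<bar>real_of_int n\<bar>) ^ k \<le> C" by blast
qed

lemma rapidly_decreasing_reflect:
  assumes "rapidly_decreasing x"
  shows "rapidly_decreasing (\<lambda>n. x (- n))"
  unfolding rapidly_decreasing_def
proof
  fix k
  obtain C where C: "\<And>n. norm (x n) * (1 + \<bar>real_of_int n\<bar>) ^ k \<le> C"
    using assms unfolding rapidly_decreasing_def by meson
  have "norm (x (- n)) * (1 + \<bar>real_of_int n\<bar>) ^ k \<le> C" for n
    using C[of "- n"] by simp
  then show "\<exists>C. \<forall>n. norm (x (- n)) * (1 + \<bar>real_of_int n\<bar>) ^ k \<le> C" by blast
qed

lemma rapidly_decreasing_poly_act:
  fixes x :: "int \<Rightarrow> 'a::{real_normed_field}"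
  assumes "rapidly_decreasing x"
  shows "rapidly_decreasing (poly_act p x)"
proof (induction p)
  case 0
  have "poly_act 0 x = (\<lambda>_. 0)" by (rule ext) simp
  then show ?case by (auto simp: rapidly_decreasing_def)
next
  case (pCons a p)
  have eq: "poly_act (pCons a p) x = (\<lambda>n. a * x n + poly_act p x (n + (- 1)))" by (rule ext) simp
  show ?case
    unfolding eq
    by (intro rapidly_decreasing_add rapidly_decreasing_shift pCons.IH
          rapidly_decreasing_dominated[OF assms, where c = "norm a"]) (simp add: norm_mult)
qed

lemma rapidly_decreasing_unit_impulse:
  "rapidly_decreasing (unit_impulse :: int \<Rightarrow> 'a::real_normed_field)"
  unfolding rapidly_decreasing_def by (intro allI exI[of _ 1]) (simp add: unit_impulse_def)

lemma summable_polynomial_times_geometric: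
  fixes r :: real
  assumes "0 \<le> r" "r < 1"
  shows "summable (\<lambda>j. (1 + real j) ^ k * r ^ j)"
proof (cases "r = 0")
  case True
  show ?thesis
    by (rule summable_finite[of "{0}"]) (use True in auto)
next
  case False
  define s where "s = (1 + r) / 2"
  have s: "r < s" "s < 1" "0 < r" using assms False by (auto simp: s_def)
  have "(\<lambda>j. ((2 + real j) / (1 + real j)) ^ k * r) \<longlonglongrightarrow> 1 ^ k * r"
  proof (intro tendsto_intros)
    show "(\<lambda>j. (2 + real j) / (1 + real j)) \<longlonglongrightarrow> 1" by real_asymp
  qed
  then have "\<forall>\<^sub>F j in sequentially. ((2 + real j) / (1 + real j)) ^ k * r < s"
    by (rule order_tendstoD) (use s in simp)
  then obtain N where N: "\<And>j. j \<ge> N \<Longrightarrow> ((2 + real j) / (1 + real j)) ^ k * r < s"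
    unfolding eventually_sequentially by blast
  show ?thesis
  proof (rule summable_ratio_test[of s N])
    fix j assume "N \<le> j"
    have "(1 + real (Suc j)) ^ k * r ^ Suc j
        = (((2 + real j) / (1 + real j)) ^ k * r) * ((1 + real j) ^ k * r ^ j)"
      by (simp add: power_divide field_simps)
    also have "\<dots> \<le> s * ((1 + real j) ^ k * r ^ j)"
      using N[OF \<open>N \<le> j\<close>] s by (intro mult_right_mono) auto
    finally show "norm ((1 + real (Suc j)) ^ k * r ^ Suc j) \<le> s * norm ((1 + real j) ^ k * r ^ j)"
      using s by simp
  qed (use s in auto)
qed

lemma contraction_weighted_bound:
  fixes a g :: "int \<Rightarrow> real"
  assumes r: "0 \<le> r" "r < 1"
    and bd: "\<And>n. a n \<le> B"
    and rec: "\<And>n. a n \<le> r * a (n - 1) + g n"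
    and g: "\<And>n. g n * (1 + \<bar>real_of_int n\<bar>) ^ k \<le> C"
  shows "\<exists>C'. \<forall>n. a n * (1 + \<bar>real_of_int n\<bar>) ^ k \<le> C'"
proof -
  define S where "S = (\<Sum>j. (1 + real j) ^ k * r ^ j)"
  note summ = summable_polynomial_times_geometric[OF r, of k]
  have iter: "a n \<le> r ^ N * a (n - int N) + (\<Sum>j<N. r ^ j * g (n - int j))" for n N
  proof (induction N)
    case (Suc N)
    have "r ^ N * a (n - int N) \<le> r ^ N * (r * a (n - int N - 1) + g (n - int N))"
      using r by (intro mult_left_mono rec) auto
    with Suc show ?case by (simp add: algebra_simps)
  qed simp
  have "a n * (1 + \<bar>real_of_int n\<bar>) ^ k \<le> \<bar>C\<bar> * S" for n
  proof -
    let ?w = "(1 + \<bar>real_of_int n\<bar>) ^ k"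
    have summand: "r ^ j * g (n - int j) * ?w \<le> \<bar>C\<bar> * ((1 + real j) ^ k * r ^ j)" for j
    proof (cases "g (n - int j) \<le> 0")
      case True
      then have "r ^ j * g (n - int j) * ?w \<le> 0"
        using r by (intro mult_nonpos_nonneg mult_nonneg_nonpos) auto
      also have "0 \<le> \<bar>C\<bar> * ((1 + real j) ^ k * r ^ j)" using r by auto
      finally show ?thesis .
    next
      case False
      have "?w \<le> ((1 + \<bar>real_of_int (n - int j)\<bar>) * (1 + \<bar>real_of_int (int j)\<bar>)) ^ k"
        using weight_le[of "n - int j" "int j"] by (intro power_mono) auto
      then have "g (n - int j) * ?w
        \<le> g (n - int j) * ((1 + \<bar>real_of_int (n - int j)\<bar>) ^ k * (1 + real j) ^ k)"
        using False by (intro mult_left_mono) (auto simp: power_mult_distrib)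
      also have "\<dots> \<le> \<bar>C\<bar> * (1 + real j) ^ k"
        unfolding mult.assoc[symmetric] using g[of "n - int j"] by (intro mult_right_mono) auto
      finally have "r ^ j * (g (n - int j) * ?w) \<le> r ^ j * (\<bar>C\<bar> * (1 + real j) ^ k)"
        using r by (intro mult_left_mono) auto
      then show ?thesis by (simp add: mult_ac)
    qed
    have fin: "a n * ?w \<le> r ^ N * (\<bar>B\<bar> * ?w) + \<bar>C\<bar> * S" for N
    proof -
      have "a n * ?w \<le> (r ^ N * a (n - int N) + (\<Sum>j<N. r ^ j * g (n - int j))) * ?w"
        by (intro mult_right_mono iter) auto
      also have "\<dots> = r ^ N * (a (n - int N) * ?w) + (\<Sum>j<N. r ^ j * g (n - int j) * ?w)"
        by (simp add: distrib_right sum_distrib_right mult.assoc)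
      also have "\<dots> \<le> r ^ N * (\<bar>B\<bar> * ?w) + (\<Sum>j<N. \<bar>C\<bar> * ((1 + real j) ^ k * r ^ j))"
        using r bd[of "n - int N"] by (intro add_mono sum_mono summand mult_left_mono mult_right_mono) auto
      also have "(\<Sum>j<N. \<bar>C\<bar> * ((1 + real j) ^ k * r ^ j)) \<le> \<bar>C\<bar> * S"
        unfolding sum_distrib_left[symmetric] S_def
        using r summ by (intro mult_left_mono sum_le_suminf) auto
      finally show ?thesis by simp
    qed
    have "(\<lambda>N. r ^ N * (\<bar>B\<bar> * ?w) + \<bar>C\<bar> * S) \<longlonglongrightarrow> 0 * (\<bar>B\<bar> * ?w) + \<bar>C\<bar> * S"
      using r by (intro tendsto_intros LIMSEQ_power_zero) auto
    from tendsto_lowerbound[OF this always_eventually[rule_format, OF fin]]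
    show ?thesis by simp
  qed
  then show ?thesis by blast
qed

lemma rapidly_decreasing_contraction:
  fixes x :: "int \<Rightarrow> 'a::real_normed_vector" and g :: "int \<Rightarrow> 'b::real_normed_vector"
  assumes "0 \<le> r" "r < 1" "\<And>n. norm (x n) \<le> B" "rapidly_decreasing g"
    and "\<And>n. norm (x n) \<le> r * norm (x (n - 1)) + norm (g n)"
  shows "rapidly_decreasing x"
  unfolding rapidly_decreasing_def
proof
  fix k
  obtain C where C: "\<And>n. norm (g n) * (1 + \<bar>real_of_int n\<bar>) ^ k \<le> C"
    using assms(4) unfolding rapidly_decreasing_def by meson
  show "\<exists>C. \<forall>n. norm (x n) * (1 + \<bar>real_of_int n\<bar>) ^ k \<le> C"
    by (rule contraction_weighted_bound[OF assms(1,2,3,5) C])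
qed

lemma rapidly_decreasing_linear_factor:
  fixes x :: "int \<Rightarrow> 'a::real_normed_field"
  assumes l: "norm l \<noteq> 1" and bd: "\<And>n. norm (x n) \<le> B"
    and rd: "rapidly_decreasing (poly_act [:- l, 1:] x)"
  shows "rapidly_decreasing x"
proof (cases "norm l < 1")
  case True
  let ?g = "poly_act [:- l, 1:] x"
  have "rapidly_decreasing (\<lambda>n. x (- n))"
  proof (rule rapidly_decreasing_contraction[OF _ True])
    show "rapidly_decreasing (\<lambda>n. ?g (- n + 1))"
      using rapidly_decreasing_reflect[OF rapidly_decreasing_shift[OF rd, of 1]] by simp
    fix n
    have "x (- n) = l * x (- (n - 1)) + ?g (- n + 1)" by simp
    then show "norm (x (- n)) \<le> norm l * norm (x (- (n - 1))) + norm (?g (- n + 1))"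
      by (metis norm_triangle_ineq norm_mult)
  qed (use bd in auto)
  from rapidly_decreasing_reflect[OF this] show ?thesis by simp
next
  case False
  with l have l1: "norm l > 1" by simp
  then have l0: "l \<noteq> 0" by auto
  let ?g = "\<lambda>n. poly_act [:- l, 1:] x n / l"
  have r: "1 / norm l < 1" using l1 by (simp add: divide_less_eq)
  show ?thesis
  proof (rule rapidly_decreasing_contraction[OF _ r])
    show "rapidly_decreasing ?g"
      by (rule rapidly_decreasing_dominated[OF rd, where c = "1 / norm l"]) (simp add: norm_divide)
    fix n
    have "x n = x (n - 1) / l - ?g n" using l0 by (simp add: field_simps)
    then have "norm (x n) \<le> norm (x (n - 1) / l) + norm (?g n)"
      by (metis norm_triangle_ineq4)
    then show "norm (x n) \<le> 1 / norm l * norm (x (n - 1)) + norm (?g n)"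
      by (simp add: norm_divide)
  qed (use bd in auto)
qed

lemma poly_act_bounded:
  fixes x :: "int \<Rightarrow> 'a::real_normed_field"
  assumes "\<And>n. norm (x n) \<le> B"
  shows "\<exists>B'. \<forall>n. norm (poly_act p x n) \<le> B'"
proof -
  have "norm (poly_act p x n) \<le> (\<Sum>j\<le>degree p. norm (coeff p j) * B)" for n
    unfolding poly_act_def
    by (rule order_trans[OF norm_sum]) (auto intro!: sum_mono mult_left_mono assms simp: norm_mult)
  then show ?thesis by blast
qed

text \<open>A Wiener-type lemma: split off one complex root at a time.\<close>
lemma rapidly_decreasing_if_poly_act:
  fixes x :: "int \<Rightarrow> complex"
  assumes "\<And>z. norm z = 1 \<Longrightarrow> poly p z \<noteq> 0"
    and "\<And>n. norm (x n) \<le> B" and "rapidly_decreasing (poly_act p x)"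
  shows "rapidly_decreasing x"
  using assms(1,3)
proof (induction "degree p" arbitrary: p)
  case 0
  then obtain a where p: "p = [:a:]" by (metis degree_eq_zeroE)
  with 0(2)[of 1] have "a \<noteq> 0" by simp
  then show ?case
    using 0(3) unfolding p
    by (intro rapidly_decreasing_dominated[where y = x and c = "1 / norm a"]) (auto simp: norm_mult)
next
  case (Suc d)
  obtain l where l: "poly p l = 0"
    using fundamental_theorem_of_algebra[of p] Suc(2) by (auto simp: constant_degree)
  then obtain q where q: "p = [:- l, 1:] * q" by (auto simp: poly_eq_0_iff_dvd)
  have "p \<noteq> 0" using Suc(2) by auto
  with q have "q \<noteq> 0" by auto
  then have "degree p = Suc (degree q)" unfolding q by (subst degree_mult_eq) auto
  with Suc(2) have "d = degree q" by simp
  moreover have "poly q z \<noteq> 0" if "norm z = 1" for z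
    using Suc(3)[OF that] by (auto simp: q)
  moreover have "rapidly_decreasing (poly_act q x)"
  proof -
    obtain B' where "\<And>n. norm (poly_act q x n) \<le> B'"
      using poly_act_bounded[of x B q, OF assms(2)] by blast
    moreover have "norm l \<noteq> 1" using l Suc(3) by blast
    moreover have "poly_act p x = poly_act [:- l, 1:] (poly_act q x)"
      unfolding q by (rule ext) (rule poly_act_mult)
    ultimately show ?thesis
      using Suc(4) by (metis rapidly_decreasing_linear_factor)
  qed
  ultimately show ?case by (rule Suc(1))
qed

section \<open>Moments\<close>

lemma summable_on_int_inverse_square:
  "(\<lambda>n::int. 1 / (1 + \<bar>real_of_int n\<bar>) ^ 2) summable_on UNIV" (is "?f summable_on _")
proof -
  have s: "(\<lambda>n::nat. 1 / (1 + real n) ^ 2) summable_on UNIV"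
  proof (rule norm_summable_imp_summable_on)
    have "summable (\<lambda>n. inverse (real (Suc n) ^ 2))"
      using inverse_power_summable[of 2, where 'a = real] by (subst summable_Suc_iff) simp
    then show "summable (\<lambda>n. norm (1 / (1 + real n) ^ 2))"
      by (simp add: inverse_eq_divide)
  qed
  have "?f summable_on range int"
    by (subst summable_on_reindex) (use s in \<open>auto simp: o_def inj_on_def\<close>)
  moreover have "?f summable_on (\<lambda>n. - int n) ` {1..}"
    by (subst summable_on_reindex)
       (use summable_on_subset_banach[OF s, of "{1..}"] in \<open>auto simp: o_def inj_on_def\<close>)
  moreover have "range int \<inter> (\<lambda>n. - int n) ` {1..} = {}" by auto
  moreover have "range int \<union> (\<lambda>n. - int n) ` {1..} = UNIV"
  proof -
    have "n \<in> range int \<union> (\<lambda>n. - int n) ` {1..}" for n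
    proof (cases "n \<ge> 0")
      case True
      then show ?thesis by (auto intro!: image_eqI[of _ _ "nat n"])
    next
      case False
      then have "n = - int (nat (- n))" "nat (- n) \<in> {1..}" by auto
      then show ?thesis by blast
    qed
    then show ?thesis by blast
  qed
  ultimately show ?thesis by (metis summable_on_Un_disjoint)
qed

definition moment :: "(int \<Rightarrow> complex) \<Rightarrow> nat \<Rightarrow> complex" where
  "moment x k = (\<Sum>\<^sub>\<infinity>n. x n * of_int n ^ k)"

lemma has_sum_moment:
  assumes "rapidly_decreasing x"
  shows "((\<lambda>n. x n * of_int n ^ k) has_sum moment x k) UNIV"
proof -
  obtain C where C: "\<And>n. norm (x n) * (1 + \<bar>real_of_int n\<bar>) ^ (k + 2) \<le> C"
    using assms unfolding rapidly_decreasing_def by meson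
  have g: "(\<lambda>n. C * (1 / (1 + \<bar>real_of_int n\<bar>) ^ 2)) summable_on UNIV"
    by (intro summable_on_cmult_right summable_on_int_inverse_square)
  have le: "norm (x n * of_int n ^ k) \<le> C * (1 / (1 + \<bar>real_of_int n\<bar>) ^ 2)" for n
  proof -
    have "norm (x n * of_int n ^ k) \<le> norm (x n) * (1 + \<bar>real_of_int n\<bar>) ^ k"
      unfolding norm_mult norm_power by (intro mult_left_mono power_mono) auto
    also have "\<dots> \<le> C * (1 / (1 + \<bar>real_of_int n\<bar>) ^ 2)"
      using C[of n] by (simp add: pos_le_divide_eq power_add power2_eq_square mult_ac)
    finally show ?thesis .
  qed
  have "(\<lambda>n. norm (x n * of_int n ^ k)) summable_on UNIV"
    by (rule Infinite_Sum.abs_summable_on_comparison_test'[OF g le])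
  then have "(\<lambda>n. x n * of_int n ^ k) summable_on UNIV" by (rule Infinite_Sum.abs_summable_summable)
  then show ?thesis unfolding moment_def by (rule has_sum_infsum)
qed

lemma has_sum_sum:
  fixes f :: "'i \<Rightarrow> 'a \<Rightarrow> 'b::topological_comm_monoid_add"
  assumes "\<And>i. i \<in> I \<Longrightarrow> (f i has_sum s i) A"
  shows "((\<lambda>x. \<Sum>i\<in>I. f i x) has_sum (\<Sum>i\<in>I. s i)) A"
  using assms by (induction I rule: infinite_finite_induct) (auto intro: has_sum_add)

lemma moment_shift:
  assumes "rapidly_decreasing x"
  shows "moment (\<lambda>n. x (n - 1)) k = (\<Sum>j\<le>k. of_nat (k choose j) * moment x j)"
proof -
  have "((\<lambda>n. \<Sum>j\<le>k. of_nat (k choose j) * (x n * of_int n ^ j)) has_sum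
          (\<Sum>j\<le>k. of_nat (k choose j) * moment x j)) UNIV"
    by (intro has_sum_sum has_sum_cmult_right has_sum_moment assms)
  also have "(\<lambda>n. \<Sum>j\<le>k. of_nat (k choose j) * (x n * of_int n ^ j)) =
               (\<lambda>n. x n * of_int (n + 1) ^ k)"
    by (simp add: binomial_ring sum_distrib_left mult_ac)
  finally have "((\<lambda>n. x (n - 1) * of_int n ^ k) has_sum
      (\<Sum>j\<le>k. of_nat (k choose j) * moment x j)) UNIV"
    using has_sum_reindex_bij_betw[of "\<lambda>n. n - 1" UNIV UNIV "\<lambda>n. x n * of_int (n + 1) ^ k"]
      bij_betwI[of "\<lambda>n::int. n - 1" UNIV UNIV "\<lambda>n. n + 1"] by simp
  then show ?thesis unfolding moment_def by (rule infsumI)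
qed

definition moment_egf :: "(int \<Rightarrow> complex) \<Rightarrow> complex fps" where
  "moment_egf x = Abs_fps (\<lambda>k. moment x k / fact k)"

lemma moment_egf_shift:
  assumes "rapidly_decreasing x"
  shows "moment_egf (\<lambda>n. x (n - 1)) = fps_exp 1 * moment_egf x"
proof (rule fps_ext)
  fix k
  have "fps_nth (moment_egf (\<lambda>n. x (n - 1))) k = (\<Sum>j\<le>k. moment x j / fact j * (1 / fact (k - j)))"
    unfolding moment_egf_def fps_nth_Abs_fps moment_shift[OF assms] sum_divide_distrib
    by (intro sum.cong) (auto simp: binomial_fact field_simps)
  also have "\<dots> = fps_nth (moment_egf x * fps_exp 1) k"
    by (simp add: fps_mult_nth moment_egf_def atMost_atLeast0)
  finally show "fps_nth (moment_egf (\<lambda>n. x (n - 1))) k = fps_nth (fps_exp 1 * moment_egf x) k"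
    by (simp add: mult.commute)
qed

lemma moment_egf_add:
  assumes "rapidly_decreasing x" "rapidly_decreasing y"
  shows "moment_egf (\<lambda>n. x n + y n) = moment_egf x + moment_egf y"
proof -
  have "moment (\<lambda>n. x n + y n) k = moment x k + moment y k" for k
    unfolding moment_def[of "\<lambda>n. x n + y n"] distrib_right
    by (intro infsumI has_sum_add has_sum_moment assms)
  then show ?thesis by (simp add: fps_eq_iff moment_egf_def add_divide_distrib)
qed

lemma moment_egf_scale: "moment_egf (\<lambda>n. a * x n) = fps_const a * moment_egf x"
proof -
  have "moment (\<lambda>n. a * x n) k = a * moment x k" for k
    unfolding moment_def mult.assoc by (rule infsum_cmult_right')
  then show ?thesis by (simp add: fps_eq_iff moment_egf_def)
qed

lemma moment_egf_unit_impulse: "moment_egf unit_impulse = 1"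
proof -
  have "moment unit_impulse k = (if k = 0 then 1 else 0)" for k
    unfolding moment_def
    by (intro infsumI has_sum_finite_neutralI[of "{0}"]) (auto simp: unit_impulse_def)
  then show ?thesis by (simp add: fps_eq_iff moment_egf_def)
qed

definition poly_exp :: "'a::field_char_0 poly \<Rightarrow> 'a fps" where
  "poly_exp p = poly (map_poly fps_const p) (fps_exp 1)"

lemma poly_exp_0 [simp]: "poly_exp 0 = 0"
  by (simp add: poly_exp_def)

lemma poly_exp_pCons [simp]: "poly_exp (pCons a p) = fps_const a + fps_exp 1 * poly_exp p"
  by (simp add: poly_exp_def map_poly_pCons)

lemma poly_exp_add: "poly_exp (p + q) = poly_exp p + poly_exp q"
  by (induction p q rule: poly_induct2) (simp_all add: algebra_simps flip: fps_const_add)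

lemma poly_exp_smult: "poly_exp (smult a p) = fps_const a * poly_exp p"
  by (induction p) (simp_all add: algebra_simps flip: fps_const_mult)

lemma poly_exp_mult: "poly_exp (p * q) = poly_exp p * poly_exp q"
  by (induction p) (simp_all add: poly_exp_add poly_exp_smult algebra_simps)

lemma poly_exp_power: "poly_exp (p ^ n) = poly_exp p ^ n"
  by (induction n) (simp_all add: poly_exp_mult one_pCons)

lemma fps_deriv_poly_exp: "fps_deriv (poly_exp p) = fps_exp 1 * poly_exp (pderiv p)"
  by (induction p) (simp_all add: pderiv_pCons poly_exp_add algebra_simps)

lemma moment_egf_poly_act:
  assumes "rapidly_decreasing x"
  shows "moment_egf (poly_act p x) = poly_exp p * moment_egf x"
proof (induction p)
  case 0
  have "poly_act 0 x = (\<lambda>n. 0 * x n)" by (rule ext) simp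
  then show ?case by (simp only: moment_egf_scale) simp
next
  case (pCons a p)
  let ?y = "poly_act p x"
  have rd: "rapidly_decreasing ?y" by (rule rapidly_decreasing_poly_act[OF assms])
  have "poly_act (pCons a p) x = (\<lambda>n. a * x n + ?y (n - 1))" by (rule ext) simp
  moreover have "rapidly_decreasing (\<lambda>n. ?y (n - 1))"
    using rapidly_decreasing_shift[OF rd, of "- 1"] by simp
  moreover have "rapidly_decreasing (\<lambda>n. a * x n)"
    by (rule rapidly_decreasing_dominated[OF assms, where c = "norm a"]) (simp add: norm_mult)
  ultimately have "moment_egf (poly_act (pCons a p) x) =
      fps_const a * moment_egf x + fps_exp 1 * moment_egf ?y"
    by (simp add: moment_egf_add moment_egf_scale moment_egf_shift[OF rd])
  then show ?case unfolding pCons.IH poly_exp_pCons by (simp only: algebra_simps)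
qed

section \<open>Zeros of the Eulerian polynomials\<close>

lemma poly_euler_num_1: "poly (euler_num n) 1 = (2 * fact n :: 'a::{idom, ring_char_0})"
  by (induction n) (simp_all add: algebra_simps)

text \<open>Up to sign, \<open>(d/d\<theta>)\<^sup>n cot (\<theta>/2)\<close> as a polynomial in \<open>cot (\<theta>/2)\<close>.\<close>
primrec cot_deriv_poly :: "nat \<Rightarrow> 'a::field_char_0 poly" where
  "cot_deriv_poly 0 = [:0, 1:]"
| "cot_deriv_poly (Suc n) = smult (1 / 2) (pderiv (cot_deriv_poly n) * [:1, 0, 1:])"

lemma coeff_cot_deriv_poly_Suc:
  "coeff (cot_deriv_poly (Suc n) :: 'a::field_char_0 poly) k =
     (of_nat (Suc k) * coeff (cot_deriv_poly n) (Suc k)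
      + (if k < 2 then 0 else of_nat (k - 1) * coeff (cot_deriv_poly n) (k - 1))) / 2"
proof -
  have "p * [:1, 0, 1:] = p + pCons 0 (pCons 0 p)" for p :: "'a poly"
    by (simp add: mult.commute[of p])
  then show ?thesis
    by (simp add: coeff_pderiv coeff_pCons numeral_2_eq_2 split: nat.splits)
qed

lemma poly_cot_deriv_poly_of_real:
  "poly (cot_deriv_poly n) (of_real c :: complex) = of_real (poly (cot_deriv_poly n) c)"
proof -
  have "coeff (cot_deriv_poly n) k = (of_real (coeff (cot_deriv_poly n) k) :: complex)" for k
  proof (induction n arbitrary: k)
    case 0
    show ?case by (auto simp: coeff_pCons split: nat.splits)
  next
    case (Suc n)
    show ?case unfolding coeff_cot_deriv_poly_Suc by (simp add: Suc.IH[symmetric])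
  qed
  then have "cot_deriv_poly n = (map_poly of_real (cot_deriv_poly n) :: complex poly)"
    by (simp add: poly_eq_iff coeff_map_poly)
  moreover have "poly (map_poly of_real p) (of_real c :: complex) = of_real (poly p c)" for p
    by (induction p) (simp_all add: map_poly_pCons)
  ultimately show ?thesis by metis
qed

lemma cot_deriv_poly_coeffs:
  "(\<forall>k. coeff (cot_deriv_poly n :: real poly) k \<ge> 0) \<and>
   (\<forall>k. even (n + k) \<longrightarrow> coeff (cot_deriv_poly n :: real poly) k = 0) \<and>
   (if even n then coeff (cot_deriv_poly n :: real poly) 1 > 0
    else coeff (cot_deriv_poly n :: real poly) 0 > 0 \<and> coeff (cot_deriv_poly n :: real poly) 2 > 0)"
proof (induction n)
  case 0
  show ?case by (auto simp: coeff_pCons split: nat.splits)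
next
  case (Suc n)
  let ?p = "cot_deriv_poly :: nat \<Rightarrow> real poly"
  have nonneg: "coeff (?p n) k \<ge> 0" for k using Suc by blast
  have "coeff (?p (Suc n)) k \<ge> 0" for k
    unfolding coeff_cot_deriv_poly_Suc using nonneg by simp
  moreover have "coeff (?p (Suc n)) k = 0" if "even (Suc n + k)" for k
  proof -
    have "coeff (?p n) (Suc k) = 0" using Suc that by simp
    moreover have "coeff (?p n) (k - 1) = 0" if "k \<ge> 2"
      using Suc \<open>even (Suc n + k)\<close> that by simp
    ultimately show ?thesis unfolding coeff_cot_deriv_poly_Suc by simp
  qed
  moreover have "coeff (?p (Suc n)) 1 > 0" if "odd n"
    using Suc that unfolding coeff_cot_deriv_poly_Suc by (simp add: numeral_2_eq_2)
  moreover have "coeff (?p (Suc n)) 0 > 0 \<and> coeff (?p (Suc n)) 2 > 0" if "even n"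
    using Suc that nonneg[of 3] unfolding coeff_cot_deriv_poly_Suc
    by (simp add: numeral_2_eq_2 numeral_3_eq_3 add_nonneg_pos)
  ultimately show ?case by auto
qed

lemma cot_deriv_poly_pos:
  assumes "odd n"
  shows "poly (cot_deriv_poly n) (c::real) > 0"
proof -
  let ?p = "cot_deriv_poly n :: real poly"
  note coeffs = cot_deriv_poly_coeffs[of n]
  have "coeff ?p 0 * c ^ 0 \<le> (\<Sum>k\<le>degree ?p. coeff ?p k * c ^ k)"
  proof (rule member_le_sum)
    fix k
    show "0 \<le> coeff ?p k * c ^ k"
    proof (cases "even k")
      case True
      then show ?thesis using coeffs by (intro mult_nonneg_nonneg zero_le_even_power) auto
    next
      case False
      then show ?thesis using coeffs assms by simp
    qed
  qed auto
  with coeffs assms show ?thesis by (simp add: poly_altdef)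
qed

lemma poly_euler_num_eq_cot_deriv_poly:
  fixes z :: complex
  assumes "z \<noteq> 1"
  shows "poly (euler_num n) z = (1 - z) ^ Suc n * \<i> ^ Suc n *
           poly (cot_deriv_poly n) (- \<i> * (1 + z) / (1 - z))"
  using assms
proof (induction n arbitrary: z)
  case 0
  then show ?case by (simp add: field_simps)
next
  case (Suc n)
  let ?P = "cot_deriv_poly n :: complex poly"
  let ?c = "\<lambda>z::complex. - \<i> * (1 + z) / (1 - z)"
  let ?F = "\<lambda>z. (1 - z) ^ Suc n * \<i> ^ Suc n * poly ?P (?c z)"
  have nz: "1 - z \<noteq> 0" using Suc.prems by simp
  have "((poly (euler_num n)) has_field_derivative poly (pderiv (euler_num n)) z) (at z)"
    by (rule poly_DERIV)
  then have d1: "(?F has_field_derivative poly (pderiv (euler_num n)) z) (at z)"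
    by (rule has_field_derivative_transform_within_open[of _ _ _ "- {1}"]) (use Suc in auto)
  have dc: "(?c has_field_derivative (- 2 * \<i> / (1 - z) ^ 2)) (at z)"
    using nz by (auto intro!: derivative_eq_intros simp: divide_simps power2_eq_square) (simp add: algebra_simps)
  have d2: "(?F has_field_derivative
      (- of_nat (Suc n) * (1 - z) ^ n * \<i> ^ Suc n * poly ?P (?c z)
       + (1 - z) ^ Suc n * \<i> ^ Suc n * (poly (pderiv ?P) (?c z) * (- 2 * \<i> / (1 - z) ^ 2)))) (at z)"
  proof -
    have "((\<lambda>z. (1 - z) ^ Suc n * \<i> ^ Suc n) has_field_derivative
        - of_nat (Suc n) * (1 - z) ^ n * \<i> ^ Suc n) (at z)"
      by (auto intro!: derivative_eq_intros simp: algebra_simps simp del: power_Suc)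
    from DERIV_mult[OF this DERIV_chain2[OF poly_DERIV dc, of ?P]] show ?thesis
      by (simp only: mult_ac)
  qed
  have e: "poly (pderiv (euler_num n)) z =
      - of_nat (Suc n) * (1 - z) ^ n * \<i> ^ Suc n * poly ?P (?c z)
       + (1 - z) ^ Suc n * \<i> ^ Suc n * (poly (pderiv ?P) (?c z) * (- 2 * \<i> / (1 - z) ^ 2))"
    by (rule DERIV_unique[OF d1 d2])
  have "poly (euler_num (Suc n)) z = z * ((1 - z) * poly (pderiv (euler_num n)) z
        + of_nat (Suc n) * poly (euler_num n) z)"
    by (simp add: algebra_simps)
  also have "\<dots> = z * ((1 - z) * (1 - z) ^ Suc n * \<i> ^ Suc n * (poly (pderiv ?P) (?c z) * (- 2 * \<i> / (1 - z) ^ 2)))"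
  proof -
    have "w * (- N * A * I * P + w * A * I * Q) + N * (w * A * I * P) = w * (w * A) * I * Q"
      for w N A I P Q :: complex
      by (simp add: algebra_simps)
    then show ?thesis unfolding e Suc.IH[OF Suc.prems] power_Suc[of "1 - z"] by metis
  qed
  also have "\<dots> = (1 - z) ^ Suc (Suc n) * \<i> ^ Suc n * poly (pderiv ?P) (?c z) * (- 2 * \<i> * z / (1 - z) ^ 2)"
    by simp
  also have "- 2 * \<i> * z / (1 - z) ^ 2 = \<i> * (1 + ?c z ^ 2) / 2"
  proof -
    have "1 + ?c z ^ 2 = ((1 - z) ^ 2 - (1 + z) ^ 2) / (1 - z) ^ 2"
      using nz by (simp add: power_divide power_mult_distrib diff_divide_distrib)
    also have "(1 - z) ^ 2 - (1 + z) ^ 2 = - 4 * z" by (simp add: power2_eq_square algebra_simps)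
    finally show ?thesis by simp
  qed
  also have "(1 - z) ^ Suc (Suc n) * \<i> ^ Suc n * poly (pderiv ?P) (?c z) * (\<i> * (1 + ?c z ^ 2) / 2)
     = (1 - z) ^ Suc (Suc n) * \<i> ^ Suc (Suc n) * (poly (pderiv ?P) (?c z) * (1 + ?c z ^ 2) / 2)"
    by (simp only: power_Suc[of \<i> "Suc n"] mult_ac times_divide_eq_right times_divide_eq_left)
  also have "poly (pderiv ?P) (?c z) * (1 + ?c z ^ 2) / 2 =
     poly (cot_deriv_poly (Suc n)) (?c z)"
  proof -
    have "poly (pderiv ?P) c * (1 + c ^ 2) / 2 = poly (cot_deriv_poly (Suc n)) c" for c
      by (simp add: power2_eq_square algebra_simps)
    then show ?thesis .
  qed
  finally show ?case .
qed

lemma euler_num_nonzero_on_circle: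
  assumes "odd n" "norm (z::complex) = 1"
  shows "poly (euler_num n) z \<noteq> 0"
proof (cases "z = 1")
  case True
  then show ?thesis by (simp add: poly_euler_num_1)
next
  case False
  define c where "c = Re (- \<i> * (1 + z) / (1 - z))"
  have "cnj (- \<i> * (1 + z) / (1 - z)) = - \<i> * (1 + z) / (1 - z)"
  proof -
    have "z \<noteq> 0" using assms(2) by auto
    moreover have "z * cnj z = 1" using complex_norm_square[of z] assms(2) by simp
    ultimately have z: "cnj z = 1 / z" "z \<noteq> 0" by (simp_all add: field_simps)
    show ?thesis using z False by (simp add: divide_simps) (simp add: algebra_simps)
  qed
  then have "- \<i> * (1 + z) / (1 - z) = of_real c"
    unfolding c_def by (metis Reals_cnj_iff of_real_Re)
  then have "poly (euler_num n) z =
      (1 - z) ^ Suc n * \<i> ^ Suc n * of_real (poly (cot_deriv_poly n) c)"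
    using poly_euler_num_eq_cot_deriv_poly[OF False, of n] by (simp add: poly_cot_deriv_poly_of_real)
  moreover have "poly (cot_deriv_poly n) c \<noteq> 0"
    using cot_deriv_poly_pos[OF assms(1), of c] by simp
  ultimately show ?thesis using False by simp
qed

section \<open>Generating functions\<close>

definition bernoulli_egf :: "complex fps" where
  "bernoulli_egf = Abs_fps (\<lambda>k. of_real (bernoulli k) / fact k)"

lemma bernoulli_egf_eq: "bernoulli_egf * fps_exp 1 = bernoulli_egf + fps_X"
proof (rule fps_ext)
  fix k
  have "(\<Sum>i\<le>k. real (k choose i) * bernoulli i) = bernoulli k + (if k = 1 then 1 else 0)"
  proof (cases "k \<le> 1")
    case True
    then have "k = 0 \<or> k = 1" by auto
    then show ?thesis by (auto simp: numeral_2_eq_2)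
  next
    case False
    then obtain n where k: "k = n + 2" using nat_le_iff_add[of 2 k] by auto
    have "(\<Sum>i\<le>n. real ((n + 2) choose i) * bernoulli i) = - (real (n + 2) * bernoulli (Suc n))"
      by (simp del: binomial_Suc_Suc)
    moreover have "(n + 2) choose Suc n = n + 2"
      using binomial_symmetric[of "Suc n" "n + 2"] by simp
    ultimately show ?thesis by (simp add: k del: binomial_Suc_Suc bernoulli.simps)
  qed
  from arg_cong[OF this, of "\<lambda>s. of_real (s / fact k) :: complex"]
  have "(\<Sum>i\<le>k. of_nat (k choose i) * of_real (bernoulli i) / fact k :: complex) =
      of_real (bernoulli k) / fact k + (if k = 1 then 1 else 0)"
    by (cases "k = 1") (simp_all add: sum_divide_distrib add_divide_distrib)
  moreover have "fps_nth (bernoulli_egf * fps_exp 1) k =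
      (\<Sum>i\<le>k. of_nat (k choose i) * of_real (bernoulli i) / fact k :: complex)"
    unfolding fps_mult_nth atMost_atLeast0
    by (intro sum.cong) (auto simp: bernoulli_egf_def binomial_fact field_simps)
  ultimately show "fps_nth (bernoulli_egf * fps_exp 1) k = fps_nth (bernoulli_egf + fps_X) k"
    by (simp add: bernoulli_egf_def)
qed

definition exp_quot :: "complex fps" where
  "exp_quot = fps_shift 1 (1 - fps_exp 1)"

lemma fps_X_mult_exp_quot: "fps_X * exp_quot = 1 - fps_exp 1"
  by (rule fps_ext) (simp add: exp_quot_def)

lemma exp_quot_nonzero: "exp_quot \<noteq> 0"
proof
  assume "exp_quot = 0"
  then have "fps_nth exp_quot 0 = 0" by simp
  then show False by (simp add: exp_quot_def)
qed

text \<open>The expansion of \<open>x\<^sup>n\<^sup>+\<^sup>1 (d/dx)\<^sup>n ((1 + e\<^sup>x) / (1 - e\<^sup>x))\<close>.\<close>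
primrec euler_quot :: "nat \<Rightarrow> complex fps" where
  "euler_quot 0 = - (2 * bernoulli_egf) - fps_X"
| "euler_quot (Suc n) = fps_X * fps_deriv (euler_quot n) - of_nat (Suc n) * euler_quot n"

lemma poly_exp_diff: "poly_exp [:1, -1:] = 1 - fps_exp (1 :: 'a::field_char_0)"
  by (simp flip: fps_const_neg)

lemma poly_exp_euler_num: "poly_exp (euler_num n) = exp_quot ^ Suc n * euler_quot n"
proof (induction n)
  case 0
  have "fps_X * (exp_quot * euler_quot 0) = (1 - fps_exp 1) * euler_quot 0"
    by (simp only: fps_X_mult_exp_quot[symmetric] mult.assoc)
  also have "\<dots> = 2 * (bernoulli_egf * fps_exp 1 - bernoulli_egf) - fps_X * (1 - fps_exp 1)"
    by (simp add: algebra_simps)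
  also have "\<dots> = fps_X * (1 + fps_exp 1)"
    unfolding bernoulli_egf_eq by (simp add: algebra_simps)
  finally have "exp_quot * euler_quot 0 = 1 + fps_exp 1"
    by (simp only: mult_left_cancel[OF fps_X_neq_zero])
  then show ?case by (simp del: euler_quot.simps)
next
  case (Suc n)
  let ?U = exp_quot and ?w = "euler_quot n" and ?e = "fps_exp 1 :: complex fps"
  have e: "?e = 1 - fps_X * ?U" by (simp add: fps_X_mult_exp_quot)
  have "fps_deriv ?e = fps_deriv (1 - fps_X * ?U)" by (simp only: e[symmetric])
  then have e': "?e = - ?U - fps_X * fps_deriv ?U" by (simp add: algebra_simps)
  have d: "fps_deriv (poly_exp (euler_num n)) =
      of_nat (Suc n) * ?U ^ n * fps_deriv ?U * ?w + ?U ^ Suc n * fps_deriv ?w"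
    unfolding Suc.IH fps_deriv_mult fps_deriv_power' diff_Suc_1 by (simp only: mult_ac add_ac)
  have "poly_exp (euler_num (Suc n)) =
      (1 - ?e) * (?e * poly_exp (pderiv (euler_num n))) + of_nat (Suc n) * ?e * poly_exp (euler_num n)"
    unfolding euler_num.simps(2) poly_exp_pCons[of 0] poly_exp_add poly_exp_mult poly_exp_smult
      poly_exp_diff fps_of_nat by (simp only: fps_const_0_eq_0 algebra_simps) simp
  also have "\<dots> = fps_X * ?U * (of_nat (Suc n) * ?U ^ n * fps_deriv ?U * ?w + ?U ^ Suc n * fps_deriv ?w)
      + of_nat (Suc n) * ?e * (?U ^ Suc n * ?w)"
    by (simp only: fps_deriv_poly_exp[symmetric] d fps_X_mult_exp_quot[symmetric]) (simp only: Suc.IH)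
  also have "\<dots> = ?U ^ Suc n * (of_nat (Suc n) * ?w * (fps_X * fps_deriv ?U + ?e) + fps_X * ?U * fps_deriv ?w)"
    by (simp only: power_Suc algebra_simps)
  also have "fps_X * fps_deriv ?U + ?e = - ?U" by (subst e') simp
  also have "?U ^ Suc n * (of_nat (Suc n) * ?w * - ?U + fps_X * ?U * fps_deriv ?w) =
      ?U ^ Suc (Suc n) * euler_quot (Suc n)"
    by (simp only: power_Suc euler_quot.simps) (simp add: algebra_simps)
  finally show ?case .
qed

lemma euler_quot_nth:
  "fps_nth (euler_quot n) k = (\<Prod>i=1..n. of_nat k - of_nat i) * fps_nth (euler_quot 0) k"
proof (induction n)
  case (Suc n)
  have "fps_nth (fps_X * fps_deriv (euler_quot n)) k = of_nat k * fps_nth (euler_quot n) k"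
    by (cases k) simp_all
  then have "fps_nth (euler_quot (Suc n)) k = (of_nat k - of_nat (Suc n)) * fps_nth (euler_quot n) k"
    by (simp add: algebra_simps fps_of_nat[symmetric])
  then show ?case by (simp only: Suc.IH) (simp add: mult_ac)
qed simp

lemma euler_quot_nth_0:
  assumes "odd n"
  shows "fps_nth (euler_quot n) 0 = 2 * fact n"
proof -
  have "(\<Prod>i=1..n. - of_nat i :: complex) = (- 1) ^ n * fact n"
    unfolding fact_prod by (simp add: prod_uminus)
  then show ?thesis using assms by (subst euler_quot_nth) (simp add: bernoulli_egf_def)
qed

lemma euler_quot_nth_eq_0:
  assumes "1 \<le> k" "k \<le> n"
  shows "fps_nth (euler_quot n) k = 0"
proof -
  have "(\<Prod>i=1..n. of_nat k - of_nat i :: complex) = 0"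
    using assms by (intro prod_zero) auto
  then show ?thesis by (subst euler_quot_nth) simp
qed

lemma euler_quot_nth_Suc:
  assumes "n \<ge> 1"
  shows "fps_nth (euler_quot n) (Suc n) = - (2 * fact n * of_real (bernoulli (Suc n)) / fact (Suc n))"
proof -
  have "(\<Prod>i=1..n. of_nat (Suc n) - of_nat i :: complex) = (\<Prod>i=1..n. of_nat i)"
    by (rule prod.reindex_bij_witness[of _ "\<lambda>i. Suc n - i" "\<lambda>i. Suc n - i"]) (auto simp: of_nat_diff)
  also have "\<dots> = fact n" by (simp add: fact_prod)
  finally show ?thesis
    using assms by (subst euler_quot_nth) (simp add: bernoulli_egf_def del: bernoulli.simps)
qed

lemma fps_nth_if_mult_eq_X_power:
  fixes v M :: "'a::comm_ring_1 fps"
  assumes v0: "fps_nth v 0 = 1" and v: "\<And>i. 0 < i \<Longrightarrow> i < N \<Longrightarrow> fps_nth v i = 0"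
    and eq: "v * M = fps_const c * fps_X ^ N" and N: "0 < N"
  shows "k < 2 * N \<Longrightarrow> fps_nth M k = (if k = N then c else 0)"
    and "fps_nth M (2 * N) = - c * fps_nth v N"
proof -
  have rec: "fps_nth M k = (if k = N then c else 0) - (\<Sum>i=1..k. fps_nth v i * fps_nth M (k - i))" for k
  proof -
    have "fps_nth (v * M) k = fps_nth v 0 * fps_nth M k + (\<Sum>i=1..k. fps_nth v i * fps_nth M (k - i))"
      unfolding fps_mult_nth by (subst sum.atLeast_Suc_atMost) auto
    then have "fps_nth M k + (\<Sum>i=1..k. fps_nth v i * fps_nth M (k - i)) = (if k = N then c else 0)"
      by (auto simp: eq v0 fps_X_power_nth)
    then show ?thesis by (simp only: eq_diff_eq)
  qed
  have low: "fps_nth M k = 0" if "k < N" for k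
  proof -
    have "(\<Sum>i=1..k. fps_nth v i * fps_nth M (k - i)) = 0"
      using that by (intro sum.neutral) (auto simp: v)
    with that show ?thesis by (subst rec) simp
  qed
  show mid: "fps_nth M k = (if k = N then c else 0)" if "k < 2 * N" for k
  proof -
    have "fps_nth v i * fps_nth M (k - i) = 0" if "i \<in> {1..k}" for i
      using that \<open>k < 2 * N\<close> by (cases "i < N") (auto simp: v low)
    then have "(\<Sum>i=1..k. fps_nth v i * fps_nth M (k - i)) = 0"
      by (intro sum.neutral) blast
    then show ?thesis by (subst rec) simp
  qed
  have "(\<Sum>i=1..2*N. fps_nth v i * fps_nth M (2 * N - i)) =
      (\<Sum>i=1..2*N. if i = N then fps_nth v N * c else 0)"
    using N by (intro sum.cong) (auto simp: mid)
  also have "\<dots> = fps_nth v N * c" using N by simp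
  finally show "fps_nth M (2 * N) = - c * fps_nth v N"
    using N by (subst rec) (simp add: mult.commute)
qed

section \<open>The discrete analogue\<close>

lemma has_sum_convolution_poly_act:
  fixes D x z :: "int \<Rightarrow> complex"
  assumes "\<And>\<beta>. ((\<lambda>\<gamma>. D \<gamma> * x (\<beta> - \<gamma>)) has_sum z \<beta>) UNIV"
  shows "((\<lambda>\<gamma>. D \<gamma> * poly_act p x (\<beta> - \<gamma>)) has_sum poly_act p z \<beta>) UNIV"
proof -
  have "((\<lambda>\<gamma>. \<Sum>j\<le>degree p. coeff p j * (D \<gamma> * x (\<beta> - int j - \<gamma>))) has_sum poly_act p z \<beta>) UNIV"
    unfolding poly_act_def by (intro has_sum_sum has_sum_cmult_right assms)
  also have "(\<lambda>\<gamma>. \<Sum>j\<le>degree p. coeff p j * (D \<gamma> * x (\<beta> - int j - \<gamma>))) =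
      (\<lambda>\<gamma>. D \<gamma> * poly_act p x (\<beta> - \<gamma>))"
    by (simp add: poly_act_def sum_distrib_left mult.left_commute algebra_simps)
  finally show ?thesis .
qed

context
  fixes m :: nat and h :: real and D :: "int \<Rightarrow> real"
  assumes m: "m \<ge> 1" and h: "h > 0" and D: "is_discrete_analogue m h D"
begin

lemma discrete_analogue_bounded: "\<exists>B. \<forall>\<gamma>. \<bar>D \<gamma>\<bar> \<le> B"
proof -
  let ?g = "G_fun m h" and ?c = "h ^ (2 * m - 1) / (2 * fact (2 * m - 1))"
  have summ: "(\<lambda>\<gamma>. \<bar>D \<gamma> * ?g (0 - \<gamma>)\<bar>) summable_on UNIV"
    using D unfolding is_discrete_analogue_def dconv_converges_def by blast
  define S where "S = (\<Sum>\<^sub>\<infinity>\<gamma>. \<bar>D \<gamma> * ?g (0 - \<gamma>)\<bar>)"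
  have c: "?c > 0" using h by simp
  have "\<bar>D \<gamma>\<bar> \<le> max \<bar>D 0\<bar> (S / ?c)" for \<gamma>
  proof (cases "\<gamma> = 0")
    case False
    have "1 \<le> \<bar>real_of_int \<gamma>\<bar>" using False by linarith
    then have "h ^ (2 * m - 1) * 1 \<le> h ^ (2 * m - 1) * \<bar>real_of_int \<gamma>\<bar> ^ (2 * m - 1)"
      using h by (intro mult_left_mono one_le_power) auto
    then have "?c \<le> h ^ (2 * m - 1) * \<bar>real_of_int \<gamma>\<bar> ^ (2 * m - 1) / (2 * fact (2 * m - 1))"
      by (intro divide_right_mono) auto
    also have "\<dots> = \<bar>?g (0 - \<gamma>)\<bar>"
      using h False by (simp add: G_fun_def abs_mult power_abs power_mult_distrib abs_sgn_eq)
    finally have "?c \<le> \<bar>?g (0 - \<gamma>)\<bar>" .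
    then have "\<bar>D \<gamma>\<bar> * ?c \<le> \<bar>D \<gamma> * ?g (0 - \<gamma>)\<bar>"
      unfolding abs_mult by (intro mult_left_mono) auto
    also have "\<dots> \<le> S"
      using finite_sum_le_infsum[OF summ, of "{\<gamma>}"] by (simp add: S_def)
    finally have "\<bar>D \<gamma>\<bar> \<le> S / ?c" using c by (simp only: pos_le_divide_eq)
    then show ?thesis by simp
  qed simp
  then show ?thesis by blast
qed

lemma poly_act_euler_num_discrete_analogue:
  "poly_act (euler_num (2 * m - 1)) (\<lambda>\<beta>. of_real (D \<beta>)) \<beta> =
     (of_real (2 * fact (2 * m - 1) / h ^ (2 * m)) :: complex)
       * poly_act ([:1, -1:] ^ (2 * m)) unit_impulse \<beta>"
proof -
  define n where "n = 2 * m - 1"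
  have n: "2 * m = Suc n" using m by (simp add: n_def)
  define \<kappa> :: complex where "\<kappa> = of_real (h ^ n / (2 * fact n))"
  let ?D = "\<lambda>\<beta>. of_real (D \<beta>) :: complex"
  let ?s = "\<lambda>\<beta>. of_int \<beta> ^ n * of_int (sgn \<beta>) :: complex"
  have G: "of_real (G_fun m h \<beta>) = \<kappa> * ?s \<beta>" for \<beta>
  proof -
    have "sgn (h * real_of_int \<beta>) = of_int (sgn \<beta>)" using h by (simp add: sgn_if zero_less_mult_iff)
    then show ?thesis by (simp add: G_fun_def \<kappa>_def power_mult_distrib n)
  qed
  have "((\<lambda>\<gamma>. ?D \<gamma> * (\<kappa> * ?s (\<beta> - \<gamma>))) has_sum 1 / of_real h * unit_impulse \<beta>) UNIV" for \<beta>
  proof -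
    have "(\<lambda>\<gamma>. \<bar>D \<gamma> * G_fun m h (\<beta> - \<gamma>)\<bar>) summable_on UNIV"
      using D unfolding is_discrete_analogue_def dconv_converges_def by blast
    then have "(\<lambda>\<gamma>. D \<gamma> * G_fun m h (\<beta> - \<gamma>)) summable_on UNIV"
      unfolding real_norm_def[symmetric] by (rule Infinite_Sum.abs_summable_summable)
    then have "((\<lambda>\<gamma>. D \<gamma> * G_fun m h (\<beta> - \<gamma>)) has_sum dconv D (G_fun m h) \<beta>) UNIV"
      unfolding dconv_def by (rule has_sum_infsum)
    moreover have "h * dconv D (G_fun m h) \<beta> = unit_impulse \<beta>"
      using D unfolding is_discrete_analogue_def ddelta_def unit_impulse_def by blast
    then have "dconv D (G_fun m h) \<beta> = 1 / h * unit_impulse \<beta>"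
      using h by (simp add: field_simps)
    ultimately have "((\<lambda>\<gamma>. D \<gamma> * G_fun m h (\<beta> - \<gamma>)) has_sum 1 / h * unit_impulse \<beta>) UNIV"
      by simp
    from has_sum_of_real[where 'a = complex, OF this]
    have "((\<lambda>\<gamma>. ?D \<gamma> * (\<kappa> * ?s (\<beta> - \<gamma>))) has_sum
        1 / of_real h * of_real (unit_impulse \<beta>)) UNIV"
      unfolding of_real_mult of_real_divide of_real_1 G .
    moreover have "of_real (unit_impulse \<beta>) = (unit_impulse \<beta> :: complex)"
      by (simp add: unit_impulse_def)
    ultimately show ?thesis by (simp only:)
  qed
  from has_sum_convolution_poly_act[OF this, of "[:1, -1:] ^ Suc n" \<beta>]
  have "((\<lambda>\<gamma>. ?D \<gamma> * (\<kappa> * poly_act (euler_num n) unit_impulse (\<beta> - \<gamma>))) has_sum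
      1 / of_real h * poly_act ([:1, -1:] ^ Suc n) unit_impulse \<beta>) UNIV"
    by (simp only: poly_act_scale poly_act_diff_power_signed)
  moreover have "((\<lambda>\<gamma>. ?D \<gamma> * unit_impulse (\<beta> - \<gamma>)) has_sum ?D \<beta>) UNIV" for \<beta>
    by (rule has_sum_finite_neutralI[of "{\<beta>}"]) (auto simp: unit_impulse_def)
  from has_sum_cmult_right[OF has_sum_convolution_poly_act[OF this, of "euler_num n" \<beta>], of \<kappa>]
  have "((\<lambda>\<gamma>. ?D \<gamma> * (\<kappa> * poly_act (euler_num n) unit_impulse (\<beta> - \<gamma>))) has_sum
      \<kappa> * poly_act (euler_num n) ?D \<beta>) UNIV"
    by (simp only: mult.left_commute)
  ultimately have "\<kappa> * poly_act (euler_num n) ?D \<beta> =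
      1 / of_real h * poly_act ([:1, -1:] ^ Suc n) unit_impulse \<beta>"
    by (metis has_sum_unique)
  then have "poly_act (euler_num n) ?D \<beta> =
      of_real (2 * fact n / h ^ Suc n) * poly_act ([:1, -1:] ^ Suc n) unit_impulse \<beta>"
    using h by (simp add: \<kappa>_def field_simps del: power_Suc poly_act_pCons) (simp add: field_simps)
  then show ?thesis by (simp only: n diff_Suc_1)
qed

lemma discrete_analogue_rapidly_decreasing:
  "rapidly_decreasing (\<lambda>\<beta>. of_real (D \<beta>) :: complex)"
proof -
  obtain B where B: "\<And>\<gamma>. \<bar>D \<gamma>\<bar> \<le> B" using discrete_analogue_bounded by blast
  have "odd (2 * m - 1)" using m by simp
  show ?thesis
  proof (rule rapidly_decreasing_if_poly_act)
    show "poly (euler_num (2 * m - 1)) z \<noteq> 0" if "norm z = 1" for z :: complex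
      by (rule euler_num_nonzero_on_circle[OF \<open>odd (2 * m - 1)\<close> that])
    show "norm (of_real (D n) :: complex) \<le> B" for n using B by simp
    show "rapidly_decreasing (poly_act (euler_num (2 * m - 1)) (\<lambda>\<beta>. of_real (D \<beta>) :: complex))"
      by (rule rapidly_decreasing_dominated[OF
            rapidly_decreasing_poly_act[OF rapidly_decreasing_unit_impulse]])
         (unfold poly_act_euler_num_discrete_analogue norm_mult, rule order_refl)
  qed
qed

lemma moment_discrete_analogue:
  fixes M
  defines "M \<equiv> \<lambda>k. moment (\<lambda>\<beta>. of_real (D \<beta>)) k"
  shows "k < 4 * m \<Longrightarrow> M k = (if k = 2 * m then of_real (fact (2 * m) / h ^ (2 * m)) else 0)"
    and "M (4 * m) =
      of_real (fact (4 * m) * bernoulli (2 * m) / (fact (2 * m) * h ^ (2 * m)))"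
proof -
  define n where "n = 2 * m - 1"
  have n: "2 * m = Suc n" "odd n" "n \<ge> 1" using m by (auto simp: n_def)
  let ?D = "\<lambda>\<beta>. of_real (D \<beta>) :: complex"
  let ?K = "of_real (2 * fact n / h ^ (2 * m)) :: complex"
  have "poly_act (euler_num n) ?D = (\<lambda>\<beta>. ?K * poly_act ([:1, -1:] ^ (2 * m)) unit_impulse \<beta>)"
    unfolding n_def by (rule ext) (rule poly_act_euler_num_discrete_analogue)
  from arg_cong[OF this, of moment_egf]
  have "poly_exp (euler_num n) * moment_egf ?D = fps_const ?K * poly_exp [:1, -1:] ^ (2 * m)"
    unfolding moment_egf_poly_act[OF discrete_analogue_rapidly_decreasing] moment_egf_scale
      moment_egf_poly_act[OF rapidly_decreasing_unit_impulse] moment_egf_unit_impulse poly_exp_power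
    by simp
  also have "poly_exp [:1, -1:] = fps_X * exp_quot"
    unfolding fps_X_mult_exp_quot by (rule poly_exp_diff)
  finally have "exp_quot ^ (2 * m) * (euler_quot n * moment_egf ?D) =
      exp_quot ^ (2 * m) * (fps_const ?K * fps_X ^ (2 * m))"
    unfolding poly_exp_euler_num n(1) power_mult_distrib by (simp only: mult_ac)
  then have "euler_quot n * moment_egf ?D = fps_const ?K * fps_X ^ (2 * m)"
    using exp_quot_nonzero by simp
  define v where "v = fps_const (1 / (2 * fact n)) * euler_quot n"
  have "v * moment_egf ?D = fps_const (1 / (2 * fact n)) * (fps_const ?K * fps_X ^ (2 * m))"
    unfolding v_def mult.assoc \<open>euler_quot n * moment_egf ?D = _\<close> ..
  also have "\<dots> = fps_const (of_real (1 / h ^ (2 * m))) * fps_X ^ (2 * m)"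
    unfolding mult.assoc[symmetric] fps_const_mult by simp
  finally have eq: "v * moment_egf ?D = fps_const (of_real (1 / h ^ (2 * m))) * fps_X ^ (2 * m)" .
  have v0: "fps_nth v 0 = 1" by (simp add: v_def euler_quot_nth_0[OF n(2)])
  have v_low: "fps_nth v i = 0" if "0 < i" "i < 2 * m" for i
    using that euler_quot_nth_eq_0[of i n] by (simp add: v_def n(1))
  have v_top: "fps_nth v (2 * m) = - of_real (bernoulli (2 * m) / fact (2 * m))"
    unfolding n(1) by (simp add: v_def euler_quot_nth_Suc[OF n(3)] del: bernoulli.simps fact_Suc)
  have M: "M k = fact k * fps_nth (moment_egf ?D) k" for k
    by (simp add: M_def moment_egf_def)
  have pos: "0 < 2 * m" and dbl: "2 * (2 * m) = 4 * m" using m by auto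
  note coeffs = fps_nth_if_mult_eq_X_power[OF v0 v_low eq pos, unfolded dbl]
  show "M k = (if k = 2 * m then of_real (fact (2 * m) / h ^ (2 * m)) else 0)" if "k < 4 * m"
    using coeffs(1)[OF _ _ that] by (simp add: M)
  show "M (4 * m) = of_real (fact (4 * m) * bernoulli (2 * m) / (fact (2 * m) * h ^ (2 * m)))"
    using coeffs(2) by (simp add: M v_top)
qed

lemma has_sum_discrete_analogue_moment:
  assumes "moment (\<lambda>\<beta>. of_real (D \<beta>)) k = of_real s"
  shows "((\<lambda>\<beta>. D \<beta> * (h * of_int \<beta>) ^ k) has_sum h ^ k * s) UNIV"
proof -
  have "((\<lambda>\<beta>. of_real (h ^ k) * (of_real (D \<beta>) * of_int \<beta> ^ k :: complex)) has_sum of_real (h ^ k) * of_real s) UNIV"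
    unfolding assms[symmetric]
    by (intro has_sum_cmult_right has_sum_moment discrete_analogue_rapidly_decreasing)
  then have "((\<lambda>\<beta>. of_real (D \<beta> * (h * of_int \<beta>) ^ k) :: complex) has_sum of_real (h ^ k * s)) UNIV"
    by (simp add: power_mult_distrib mult_ac)
  then show ?thesis by (simp only: has_sum_of_real_iff)
qed

end

theorem mainTheorem3:
  fixes m :: nat and h :: real and D :: "int \<Rightarrow> real"
  assumes "m \<ge> 1" and "h > 0" and "is_discrete_analogue m h D"
  shows "(\<forall>k::nat. k \<le> 2 * m - 1 \<longrightarrow>
            ((\<lambda>\<beta>. D \<beta> * (h * of_int \<beta>) ^ k) has_sum 0) UNIV) \<and>
         ((\<lambda>\<beta>. D \<beta> * (h * of_int \<beta>) ^ (2 * m)) has_sum fact (2 * m)) UNIV \<and>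
         (\<forall>k::nat. 2 * m + 1 \<le> k \<and> k \<le> 4 * m - 1 \<longrightarrow>
            ((\<lambda>\<beta>. D \<beta> * (h * of_int \<beta>) ^ k) has_sum 0) UNIV) \<and>
         ((\<lambda>\<beta>. D \<beta> * (h * of_int \<beta>) ^ (4 * m)) has_sum
            (h ^ (2 * m) * fact (4 * m) * bernoulli (2 * m) / fact (2 * m))) UNIV"
proof -
  note moments = moment_discrete_analogue[OF assms] and sums = has_sum_discrete_analogue_moment[OF assms]
  have zero: "((\<lambda>\<beta>. D \<beta> * (h * of_int \<beta>) ^ k) has_sum 0) UNIV" if "k < 4 * m" "k \<noteq> 2 * m" for k
    using sums[of k 0] moments(1)[of k] that by simp
  have "((\<lambda>\<beta>. D \<beta> * (h * of_int \<beta>) ^ (2 * m)) has_sum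
      h ^ (2 * m) * (fact (2 * m) / h ^ (2 * m))) UNIV"
    by (rule sums) (use moments(1)[of "2 * m"] assms(1) in simp)
  then have two: "((\<lambda>\<beta>. D \<beta> * (h * of_int \<beta>) ^ (2 * m)) has_sum fact (2 * m)) UNIV"
    using assms(2) by simp
  have "h ^ (4 * m) = h ^ (2 * m) * h ^ (2 * m)" by (simp flip: power_add)
  then have "h ^ (4 * m) * (fact (4 * m) * bernoulli (2 * m) / (fact (2 * m) * h ^ (2 * m))) =
      h ^ (2 * m) * fact (4 * m) * bernoulli (2 * m) / fact (2 * m)"
    using assms(2) by simp
  with sums[OF moments(2)] have four: "((\<lambda>\<beta>. D \<beta> * (h * of_int \<beta>) ^ (4 * m)) has_sum
      (h ^ (2 * m) * fact (4 * m) * bernoulli (2 * m) / fact (2 * m))) UNIV"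
    by simp
  show ?thesis
  proof (intro conjI allI impI)
    fix k assume "k \<le> 2 * m - 1"
    with assms(1) have "k < 4 * m" "k \<noteq> 2 * m" by auto
    then show "((\<lambda>\<beta>. D \<beta> * (h * of_int \<beta>) ^ k) has_sum 0) UNIV" by (rule zero)
  next
    fix k assume "2 * m + 1 \<le> k \<and> k \<le> 4 * m - 1"
    with assms(1) have "k < 4 * m" "k \<noteq> 2 * m" by auto
    then show "((\<lambda>\<beta>. D \<beta> * (h * of_int \<beta>) ^ k) has_sum 0) UNIV" by (rule zero)
  qed (rule two four)+
qed

end
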